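(* Let $a=(3,1)\in\mathbb R^2$ and let $K\subseteq\mathbb R^2$ be the compact set $$K=\big([-1,1]\times[-1,1]\big)\cup\big([-3,3]\times\{1\}\big)\cup\big([1,3]\times\{-1\}\big)\cup\big(\{-3\}\times[1,3]\big)\cup\big(\{3\}\times[-3,-1]\big).$$ Define $u_1,u_2,F,f:\mathbb R^2\to[0,\infty)$ by $$u_1(p)=\max\{0,\ 1-d_\infty(p,K),\ 5-5d_\infty(p,a)\},\qquad u_2(p)=u_1(p^* ),$$ $$F(p)=u_1(p)+u_2(p),\qquad f(p)=\sqrt{u_1(p)+u_2(p)},$$ where $p^*=(y,x)$ for $p=(x,y)$. Then $\mathbf{ucat}^2(f)=\mathbf{ucat}(F)=2$ and $\mathbf{ucat}(f)\ge 3$. (In particular, $f$ is a counterexample to the conjecture that $\mathbf{ucat}^{p_1}(f)\le\mathbf{ucat}^{p_2}(f)$ for all $0<p_1<p_2\le\infty$.)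
   Context: A continuous function $u:X\to[0,\infty)$ on a topological space is unimodal if there is $M>0$ such that the superlevel set $u^{-1}[c,\infty)$ is contractible for $0<c\le M$ and empty for $c>M$. For $p\in(0,\infty)$, the unimodal $p$-category $\mathbf{ucat}^p(f)$ of $f:X\to[0,\infty)$ is the minimum number $n$ of unimodal functions $u_1,\dots,u_n:X\to[0,\infty)$ such that pointwise $f=\left(\sum_{i=1}^n u_i^p\right)^{1/p}$; $\mathbf{ucat}=\mathbf{ucat}^1$. $d_\infty$ denotes the distance on $\mathbb R^2$ induced by the max-norm $\|(x,y)\|_\infty=\max\{|x|,|y|\}$, and $d_\infty(p,K)=\inf_{k\in K}d_\infty(p,k)$. *)

theory Defs
  imports "HOL-Analysis.Analysis" "HOL-Library.Extended_Nat"
begin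

(* The library's contractible holds vacuously of the empty set, whereas a contractible
   space is by convention nonempty (so the zero function is not unimodal); hence the
   explicit nonemptiness condition. *)
definition unimodal :: "('a::topological_space \<Rightarrow> real) \<Rightarrow> bool" where
  "unimodal u \<longleftrightarrow>
     continuous_on UNIV u \<and> (\<forall>x. 0 \<le> u x) \<and>
     (\<exists>M>0. (\<forall>c. 0 < c \<and> c \<le> M \<longrightarrow> u -` {c..} \<noteq> {} \<and> contractible (u -` {c..})) \<and>
            (\<forall>c>M. u -` {c..} = {}))"

(* Meant for 0 < p and nonnegative f. The infimum of a nonempty subset of enat is its
   minimum; if f admits no finite decomposition, the value is infinity. *)
definition ucat_pow :: "real \<Rightarrow> ('a::topological_space \<Rightarrow> real) \<Rightarrow> enat" where
  "ucat_pow p f = Inf {enat n | n. \<exists>u :: nat \<Rightarrow> 'a \<Rightarrow> real.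
     (\<forall>i<n. unimodal (u i)) \<and> (\<forall>x. f x = (\<Sum>i<n. u i x powr p) powr (1 / p))}"

abbreviation ucat :: "('a::topological_space \<Rightarrow> real) \<Rightarrow> enat" where
  "ucat \<equiv> ucat_pow 1"

(* The library's dist on pairs is Euclidean, so the max-norm distance is defined separately. *)
definition dist_max :: "real \<times> real \<Rightarrow> real \<times> real \<Rightarrow> real" where
  "dist_max p q = max \<bar>fst p - fst q\<bar> \<bar>snd p - snd q\<bar>"

definition setdist_max :: "real \<times> real \<Rightarrow> (real \<times> real) set \<Rightarrow> real" where
  "setdist_max p K = (INF k\<in>K. dist_max p k)"

end

theory Submission
  imports Defs
begin

text \<open>
  Both upper bounds come from the two given bumps: \<open>F = u1 + u2\<close>, and \<open>f\<close> is the \<open>2\<close>-sum of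
  \<open>sqrt u1\<close> and \<open>sqrt u2\<close>. The bump \<open>u1\<close> is unimodal because its superlevel sets are trees of
  rectangles (\<open>AR_bump_superlevel\<close>). One summand never suffices, since the two peaks \<open>(3, 1)\<close> and
  \<open>(1, 3)\<close> of \<open>F\<close> lie in different components of the top superlevel set.

  Suppose now that \<open>f = v + w\<close> with \<open>v\<close> and \<open>w\<close> unimodal. Each peak is the end of an arm on which
  \<open>f\<close> drops to 1, so a superlevel set above level 1 cannot contain both peaks. As \<open>f = sqrt 5 > 2\<close>
  at the peaks, one of the two peaks belongs to \<open>v\<close> and the other to \<open>w\<close>, say \<open>v > 1\<close> at \<open>(3, 1)\<close> and
  \<open>w > 1\<close> at \<open>(1, 3)\<close>; away from its own peak each summand is at most 1 (\<open>unimodal_peak_box\<close>).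

  The arms of \<open>K\<close> and of its transpose enclose two holes, around \<open>(-2, 2)\<close> and \<open>(2, -2)\<close>, at whose
  centres \<open>f\<close> vanishes. A contractible superlevel set cannot contain a loop around a hole,
  so on each enclosing square both \<open>v\<close> and \<open>w\<close> have zeros (\<open>unimodal_vanishes_on_ring\<close>). At a zero
  of \<open>w\<close> on such a square \<open>v = f \<ge> 1\<close>, whence \<open>f = 1\<close>; this happens only on thin arcs of the square,
  from which one can walk off to infinity through the region \<open>f < 1\<close>. Thus the connected set \<open>v \<ge> 1\<close>
  joins \<open>(3, 1)\<close> to the ring at the upper left, and the connected set \<open>w \<ge> 1\<close> joins \<open>(1, 3)\<close> to the
  ring at the lower right. Seen from infinity these four ends alternate, so the two sets, prolonged
  to infinity, must cross (\<open>path_connected_sets_cross\<close>). A crossing would be a point with \<open>f \<ge> 2\<close>, but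
  \<open>f \<le> sqrt 2\<close> away from the peaks, and near each peak only one of the two sets is present.
\<close>

section \<open>Superlevel sets of the tree-shaped bump\<close>

definition rect_dist :: "real \<Rightarrow> real \<Rightarrow> real \<Rightarrow> real \<Rightarrow> real \<times> real \<Rightarrow> real" where
  "rect_dist l r b t p = max 0 (max (max (l - fst p) (fst p - r)) (max (b - snd p) (snd p - t)))"

lemma INF_dist_max_rectangle:
  assumes "l \<le> r" "b \<le> t"
  shows "(INF k\<in>{l..r} \<times> {b..t}. dist_max p k) = rect_dist l r b t p"
proof -
  obtain x y where p: "p = (x, y)" by (cases p)
  let ?k = "(max l (min r x), max b (min t y))"
  show ?thesis
  proof (rule cInf_eq_minimum)
    have "?k \<in> {l..r} \<times> {b..t}" using assms by auto
    moreover have "dist_max p ?k = rect_dist l r b t p"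
      using assms by (auto simp: p dist_max_def rect_dist_def max_def min_def)
    ultimately show "rect_dist l r b t p \<in> dist_max p ` ({l..r} \<times> {b..t})"
      by (metis imageI)
  next
    fix d assume "d \<in> dist_max p ` ({l..r} \<times> {b..t})"
    then show "rect_dist l r b t p \<le> d"
      by (auto simp: p dist_max_def rect_dist_def)
  qed
qed

lemma setdist_max_Un:
  assumes "A \<noteq> {}" "B \<noteq> {}"
  shows "setdist_max p (A \<union> B) = min (setdist_max p A) (setdist_max p B)"
proof -
  have "bdd_below (dist_max p ` C)" for C
    by (rule bdd_belowI[of _ 0]) (auto simp: dist_max_def)
  then show ?thesis
    using assms by (simp add: setdist_max_def cINF_union inf_min)
qed

text \<open>The max-norm distance from \<open>K\<close>, a tree of five rectangles of which four are segments.\<close>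
definition spine_dist :: "real \<times> real \<Rightarrow> real" where
  "spine_dist p = min (rect_dist (-1) 1 (-1) 1 p) (min (rect_dist (-3) 3 1 1 p)
     (min (rect_dist 1 3 (-1) (-1) p)
     (min (rect_dist (-3) (-3) 1 3 p) (rect_dist 3 3 (-3) (-1) p))))"

definition bump :: "real \<times> real \<Rightarrow> real" where
  "bump p = max 0 (max (1 - spine_dist p) (5 - 5 * dist_max p (3, 1)))"

lemma setdist_max_spine:
  "setdist_max p (({-1..1} \<times> {-1..1}) \<union> ({-3..3} \<times> {1}) \<union> ({1..3} \<times> {-1})
                \<union> ({-3} \<times> {1..3}) \<union> ({3} \<times> {-3..-1})) = spine_dist p"
proof -
  have R: "setdist_max p ({l..r} \<times> {b..t}) = rect_dist l r b t p" if "l \<le> r" "b \<le> t" for l r b t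
    using INF_dist_max_rectangle[OF that] by (simp add: setdist_max_def)
  have S: "{-3..3} \<times> {1::real} = {-3..3::real} \<times> {1..1}"
      "{1..3::real} \<times> {-1::real} = {1..3} \<times> {-1.. -1}"
      "{-3::real} \<times> {1..3::real} = {-3.. -3} \<times> {1..3}"
      "{3::real} \<times> {-3..-1::real} = {3..3} \<times> {-3.. -1}"
    by auto
  show ?thesis
    unfolding S by (simp add: setdist_max_Un R spine_dist_def min.assoc del: atLeastAtMost_singleton)
qed

definition thick :: "real \<Rightarrow> real \<Rightarrow> real \<Rightarrow> real \<Rightarrow> real \<Rightarrow> (real \<times> real) set" where
  "thick l r b t d = {l - d..r + d} \<times> {b - d..t + d}"

lemma rect_dist_le_iff: "rect_dist l r b t p \<le> d \<longleftrightarrow> 0 \<le> d \<and> p \<in> thick l r b t d"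
  by (cases p) (auto simp: rect_dist_def thick_def)

text \<open>Inflating a rectangle by \<open>d\<close> gives the points at distance at most \<open>d\<close> from it, so every
  superlevel set is a union of rectangles. The condition \<open>c \<le> 1\<close> matters: an inflation by a negative
  amount shrinks the central square without emptying it. The slope 5 at the peak turns the level
  \<open>c\<close> into the radius \<open>1 - c / 5\<close>.\<close>
lemma bump_superlevel:
  assumes "0 < c"
  shows "c \<le> bump p \<longleftrightarrow>
    (c \<le> 1 \<and> p \<in> thick (-1) 1 (-1) 1 (1 - c) \<union> thick (-3) 3 1 1 (1 - c)
        \<union> thick 1 3 (-1) (-1) (1 - c) \<union> thick (-3) (-3) 1 3 (1 - c) \<union> thick 3 3 (-3) (-1) (1 - c))
    \<or> p \<in> thick 3 3 1 1 (1 - c / 5)"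
proof -
  have "c \<le> bump p \<longleftrightarrow> spine_dist p \<le> 1 - c \<or> dist_max p (3, 1) \<le> 1 - c / 5"
    using assms by (auto simp: bump_def le_max_iff_disj)
  moreover have "dist_max p (3, 1) \<le> 1 - c / 5 \<longleftrightarrow> p \<in> thick 3 3 1 1 (1 - c / 5)"
    by (cases p) (auto simp: dist_max_def thick_def abs_le_iff)
  ultimately show ?thesis
    unfolding spine_dist_def min_le_iff_disj rect_dist_le_iff by auto
qed

lemma continuous_bump: "continuous_on UNIV bump"
  unfolding bump_def spine_dist_def rect_dist_def dist_max_def
  by (intro continuous_intros)

lemma bump_nonneg: "0 \<le> bump p" by (simp add: bump_def)

lemma AR_thick: "thick l r b t d \<noteq> {} \<Longrightarrow> AR (thick l r b t d)"
  unfolding thick_def by (intro convex_imp_AR convex_Times) auto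

lemma closed_thick: "closed (thick l r b t d)"
  unfolding thick_def by (intro closed_Times) auto

text \<open>Absolute retracts are contractible and, unlike contractible sets, are stable under gluing
  along a closed absolute retract; attaching a rectangle along a rectangle is the case needed.\<close>
lemma AR_Un_thick:
  assumes "AR S \<and> closed S" "S \<inter> thick l r b t d = thick l' r' b' t' d'"
    "l' - d' \<le> r' + d'" "b' - d' \<le> t' + d'"
  shows "AR (S \<union> thick l r b t d) \<and> closed (S \<union> thick l r b t d)"
proof -
  have "thick l' r' b' t' d' \<noteq> {}" using assms(3,4) by (simp add: thick_def)
  moreover from this have "thick l r b t d \<noteq> {}" using assms(2) by blast
  ultimately show ?thesis using assms(1,2) AR_thick closed_thick
    by (metis AR_closed_Un closed_Un)
qed

text \<open>Up to level 1 the superlevel set is a tree of rectangles: each rectangle in the order chosen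
  here meets the union of the earlier ones in a single rectangle, since the inflation \<open>d < 1\<close> is too
  small to join two parts of the spine that are not already adjacent. Above level 1 only the peak
  remains.\<close>
lemma AR_bump_superlevel:
  assumes "0 < c" "c \<le> 5"
  shows "AR (bump -` {c..})"
proof (cases "c \<le> 1")
  case False
  then have "bump -` {c..} = thick 3 3 1 1 (1 - c / 5)"
    using bump_superlevel[OF assms(1)] by auto
  moreover have "(3, 1) \<in> thick 3 3 1 1 (1 - c / 5)"
    using assms by (auto simp: thick_def)
  ultimately show ?thesis using AR_thick by (metis empty_iff)
next
  case True
  define d where "d = 1 - c"
  define h where "h = 1 - c / 5"
  have d: "0 \<le> d" "d < 1" "d \<le> h" "h < 1" using True assms by (auto simp: d_def h_def)
  define S1 where "S1 = thick (-3) 3 1 1 d"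
  define S2 where "S2 = S1 \<union> thick (-3) (-3) 1 3 d"
  define S3 where "S3 = S2 \<union> thick (-1) 1 (-1) 1 d"
  define S4 where "S4 = S3 \<union> thick 1 3 (-1) (-1) d"
  define S5 where "S5 = S4 \<union> thick 3 3 (-3) (-1) d"
  have "thick (-3) 3 1 1 d \<noteq> {}" using d by (simp add: thick_def)
  then have 1: "AR S1 \<and> closed S1"
    unfolding S1_def using AR_thick closed_thick by metis
  have "S1 \<inter> thick (-3) (-3) 1 3 d = thick (-3) (-3) 1 1 d"
    using d by (auto simp: thick_def S1_def)
  from AR_Un_thick[OF 1 this] have 2: "AR S2 \<and> closed S2" using d by (simp add: S2_def)
  have "S2 \<inter> thick (-1) 1 (-1) 1 d = thick (-1) 1 1 1 d"
    using d by (auto simp: thick_def S1_def S2_def)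
  from AR_Un_thick[OF 2 this] have 3: "AR S3 \<and> closed S3" using d by (simp add: S3_def)
  have "S3 \<inter> thick 1 3 (-1) (-1) d = thick 1 1 (-1) (-1) d"
    using d by (auto simp: thick_def S1_def S2_def S3_def)
  from AR_Un_thick[OF 3 this] have 4: "AR S4 \<and> closed S4" using d by (simp add: S4_def)
  have "S4 \<inter> thick 3 3 (-3) (-1) d = thick 3 3 (-1) (-1) d"
    using d by (auto simp: thick_def S1_def S2_def S3_def S4_def)
  from AR_Un_thick[OF 4 this] have 5: "AR S5 \<and> closed S5" using d by (simp add: S5_def)
  have "S5 \<inter> thick 3 3 1 1 h = thick (3 - h + d) 3 1 1 d"
    using d by (auto simp: thick_def S1_def S2_def S3_def S4_def S5_def)
  from AR_Un_thick[OF 5 this] have "AR (S5 \<union> thick 3 3 1 1 h)" using d by simp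
  moreover have "bump -` {c..} = S5 \<union> thick 3 3 1 1 h"
    using bump_superlevel[OF assms(1)] True
    by (auto simp: S1_def S2_def S3_def S4_def S5_def d_def h_def)
  ultimately show ?thesis by simp
qed

lemma bump_le_5: "bump p \<le> 5"
proof (rule ccontr)
  assume "\<not> bump p \<le> 5"
  then show False
    using bump_superlevel[of "bump p" p] by (auto simp: thick_def)
qed

lemma unimodal_bump: "unimodal bump"
proof -
  have "bump -` {c..} \<noteq> {} \<and> contractible (bump -` {c..})" if "0 < c" "c \<le> 5" for c
    using AR_bump_superlevel[OF that] AR_imp_contractible bump_superlevel[OF that(1), of "(3, 1)"] that
    by (auto simp: thick_def)
  moreover have "bump -` {c..} = {}" if "c > 5" for c
    using that bump_le_5 by (metis atLeast_iff equals0I not_le order_less_le_trans vimageE order_trans)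
  ultimately show ?thesis
    unfolding unimodal_def using continuous_bump bump_nonneg by (metis zero_less_numeral)
qed

section \<open>Operations preserving unimodality\<close>

lemma unimodal_swap:
  fixes u :: "'a::real_normed_vector \<times> 'a \<Rightarrow> real"
  assumes "unimodal u"
  shows "unimodal (u \<circ> prod.swap)"
proof -
  have eq: "(u \<circ> prod.swap) -` C = prod.swap ` (u -` C)" for C
    by (force simp: image_iff)
  have h: "contractible ((u \<circ> prod.swap) -` C)" if "contractible (u -` C)" for C
  proof -
    have "homeomorphism (u -` C) (prod.swap ` (u -` C)) prod.swap prod.swap"
      by (auto simp: homeomorphism_def image_image intro!: continuous_on_swap)
    then show ?thesis
      unfolding eq using that homeomorphic_contractible_eq homeomorphic_def by blast
  qed
  have n: "(u \<circ> prod.swap) -` C = {} \<longleftrightarrow> u -` C = {}" for C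
    unfolding eq by simp
  have "continuous_on UNIV (u \<circ> prod.swap)"
    using assms unfolding unimodal_def
    by (intro continuous_on_compose continuous_on_swap) (auto intro: continuous_on_subset)
  then show ?thesis
    using assms h unfolding unimodal_def n by (metis comp_apply)
qed

lemma unimodal_sqrt:
  assumes "unimodal u"
  shows "unimodal (\<lambda>x. sqrt (u x))"
proof -
  obtain M where M: "M > 0" "\<And>c. 0 < c \<Longrightarrow> c \<le> M \<Longrightarrow> u -` {c..} \<noteq> {} \<and> contractible (u -` {c..})"
    "\<And>c. c > M \<Longrightarrow> u -` {c..} = {}"
    using assms unfolding unimodal_def by metis
  have eq: "(\<lambda>x. sqrt (u x)) -` {c..} = u -` {c\<^sup>2..}" if "c > 0" for c
  proof -
    have "c \<le> sqrt y \<longleftrightarrow> c\<^sup>2 \<le> y" for y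
      using that real_le_rsqrt[of c y] sqrt_ge_absD[of c y] by auto
    then show ?thesis by auto
  qed
  show ?thesis
    unfolding unimodal_def
  proof (intro conjI allI exI[of _ "sqrt M"] impI)
    show "continuous_on UNIV (\<lambda>x. sqrt (u x))"
      using assms by (auto simp: unimodal_def intro: continuous_on_real_sqrt)
    fix c assume "c > sqrt M"
    moreover from this have "c\<^sup>2 > M"
      using M(1) by (metis not_less real_le_rsqrt)
    moreover have "0 < c" using M(1) calculation(1) by (meson less_trans real_sqrt_gt_zero)
    ultimately show "(\<lambda>x. sqrt (u x)) -` {c..} = {}" using eq M(3) by simp
  next
    fix c assume "0 < c \<and> c \<le> sqrt M"
    moreover from this have "c\<^sup>2 \<le> M" using M(1) by (metis less_eq_real_def real_sqrt_le_iff real_sqrt_unique)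
    ultimately show "(\<lambda>x. sqrt (u x)) -` {c..} \<noteq> {}" "contractible ((\<lambda>x. sqrt (u x)) -` {c..})"
      using eq M(2)[of "c\<^sup>2"] by auto
  qed (use assms M in \<open>auto simp: unimodal_def\<close>)
qed

section \<open>The terrain of the sum of the two bumps\<close>

text \<open>Necessary conditions on \<open>(x, y)\<close> for \<open>bump (x, y) = s\<close>: if \<open>s\<close> is positive, one disjunct for
  each rectangle of the spine and the last for the peak. They are spelt out as linear inequalities, so that estimates
  of \<open>height\<close> become case distinctions in linear arithmetic.\<close>
definition bump_branch :: "real \<Rightarrow> real \<Rightarrow> real \<Rightarrow> bool" where
  "bump_branch s x y \<longleftrightarrow> s = 0 \<or> 0 < s \<and>
     (s \<le> 1 \<and> s - 2 \<le> x \<and> x \<le> 2 - s \<and> s - 2 \<le> y \<and> y \<le> 2 - s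
    \<or> s \<le> 1 \<and> s - 4 \<le> x \<and> x \<le> 4 - s \<and> s \<le> y \<and> y \<le> 2 - s
    \<or> s \<le> 1 \<and> s \<le> x \<and> x \<le> 4 - s \<and> s - 2 \<le> y \<and> y \<le> - s
    \<or> s \<le> 1 \<and> s - 4 \<le> x \<and> x \<le> - 2 - s \<and> s \<le> y \<and> y \<le> 4 - s
    \<or> s \<le> 1 \<and> s + 2 \<le> x \<and> x \<le> 4 - s \<and> s - 4 \<le> y \<and> y \<le> - s
    \<or> s \<le> 5 \<and> 2 + s / 5 \<le> x \<and> x \<le> 4 - s / 5 \<and> s / 5 \<le> y \<and> y \<le> 2 - s / 5)"

lemma bump_branch_bump: "bump_branch (bump (x, y)) x y"
proof (cases "bump (x, y) = 0")
  case False
  then have "0 < bump (x, y)" using bump_nonneg[of "(x, y)"] by linarith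
  then show ?thesis
    using bump_superlevel[of "bump (x, y)" "(x, y)"] bump_le_5[of "(x, y)"]
    unfolding bump_branch_def thick_def by simp argo
qed (simp add: bump_branch_def)

definition height :: "real \<times> real \<Rightarrow> real" where
  "height p = bump p + bump (prod.swap p)"

lemma height_swap [simp]: "height (prod.swap p) = height p"
  by (simp add: height_def)

lemma height_cases:
  obtains s t where "height (x, y) = s + t" "bump_branch s x y" "bump_branch t y x"
  using bump_branch_bump[of x y] bump_branch_bump[of y x] by (simp add: height_def)

lemma height_peak: "height (3, 1) = 5"
proof -
  obtain s t where "height (3, 1) = s + t" "bump_branch s 3 1" "bump_branch t 1 3"
    by (rule height_cases)
  then have "height (3, 1) \<le> 5"
    unfolding bump_branch_def by (elim disjE conjE; linarith)
  moreover have "5 \<le> bump (3, 1)"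
    using bump_superlevel[of 5 "(3, 1)"] by (simp add: thick_def)
  ultimately show ?thesis
    using bump_nonneg[of "(1, 3)"] by (simp add: height_def)
qed

text \<open>Two summands of at most 1 each. Hence \<open>sqrt height < 2\<close> away from the peaks, so that two
  functions summing to it cannot both be at least 1 there. The height itself reaches 2 on the
  square, where such a pair does exist; this is the place where the square root is decisive.\<close>
lemma height_off_peaks:
  assumes "p \<notin> {2..4} \<times> {0..2}" "p \<notin> {0..2} \<times> {2..4}"
  shows "height p \<le> 2"
proof -
  obtain x y where p: "p = (x, y)" by (cases p)
  obtain s t where *: "height (x, y) = s + t" "bump_branch s x y" "bump_branch t y x"
    by (rule height_cases)
  have "s \<le> 1"
    using *(2) assms(1) unfolding p bump_branch_def by auto
  moreover have "t \<le> 1"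
    using *(3) assms(2) unfolding p bump_branch_def by auto
  ultimately show ?thesis using * p by simp
qed

text \<open>The peak box \<open>[2,4] \<times> [0,2]\<close> is a moat around the peak \<open>(3, 1)\<close>: its boundary has distance 1 from
  the peak and at least 1 from the transposed spine, and it meets the spine itself only in \<open>(2, 1)\<close>.\<close>
lemma height_gate:
  assumes "(x, y) \<in> {2..4} \<times> {0..2}" "x = 2 \<or> x = 4 \<or> y = 0 \<or> y = 2" "height (x, y) \<ge> 1"
  shows "(x, y) = (2, 1)"
proof -
  obtain s t where *: "height (x, y) = s + t" "bump_branch s x y" "bump_branch t y x"
    by (rule height_cases)
  have xy: "2 \<le> x" "x \<le> 4" "0 \<le> y" "y \<le> 2" using assms(1) by auto
  then have "t = 0"
    using *(3) unfolding bump_branch_def by (elim disjE conjE; linarith)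
  then have s: "1 \<le> s" using * assms by simp
  have "x \<le> 2 \<and> 1 \<le> y \<and> y \<le> 1"
    using *(2) s assms(2) xy unfolding bump_branch_def by (elim disjE conjE; linarith)
  then show ?thesis using xy by auto
qed

lemma height_gate_eq: "height (2, 1) = 1"
proof -
  obtain s t where "height (2, 1) = s + t" "bump_branch s 2 1" "bump_branch t 1 2"
    by (rule height_cases)
  then have "height (2, 1) \<le> 1"
    unfolding bump_branch_def by (elim disjE conjE; linarith)
  moreover have "1 \<le> bump (2, 1)"
    using bump_superlevel[of 1 "(2, 1)"] by (simp add: thick_def)
  ultimately show ?thesis
    using bump_nonneg[of "(1, 2)"] by (simp add: height_def)
qed

lemma height_support:
  assumes "0 < height (x, y)"
  shows "- 4 \<le> x \<and> x \<le> 4 \<and> - 4 \<le> y \<and> y \<le> 4"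
proof -
  obtain s t where *: "height (x, y) = s + t" "bump_branch s x y" "bump_branch t y x"
    by (rule height_cases)
  then consider "s > 0" | "t > 0" using assms by linarith
  then show ?thesis
  proof cases
    case 1
    then show ?thesis using *(2) unfolding bump_branch_def by auto
  next
    case 2
    then show ?thesis using *(3) unfolding bump_branch_def by auto
  qed
qed

lemma height_hole: "height (-2, 2) = 0"
proof -
  obtain s t where "height (-2, 2) = s + t" "bump_branch s (-2) 2" "bump_branch t 2 (-2)"
    by (rule height_cases)
  then show ?thesis
    unfolding bump_branch_def by (elim disjE conjE; linarith)
qed

text \<open>The boundary of this square lies in the union of the spine and its transpose, which close up
  at \<open>(-3, 3)\<close>; the square surrounds the hole at \<open>(-2, 2)\<close>.\<close>
lemma height_ring:
  assumes "(x, y) \<in> {-3..-1} \<times> {1..3}" "x = -3 \<or> x = -1 \<or> y = 1 \<or> y = 3"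
  shows "1 \<le> height (x, y)"
proof -
  have "1 \<le> bump (x, y) \<or> 1 \<le> bump (y, x)"
    using assms bump_superlevel[of 1 "(x, y)"] bump_superlevel[of 1 "(y, x)"]
    by (auto simp: thick_def)
  then show ?thesis
    using bump_nonneg[of "(x, y)"] bump_nonneg[of "(y, x)"] by (auto simp: height_def)
qed

text \<open>Near the corners \<open>(-1, 1)\<close> and \<open>(-3, 3)\<close> both summands contribute and the height exceeds 1.
  What is left are arcs where the set \<open>height \<ge> 1\<close> is only a curve.\<close>
lemma height_ring_thin:
  assumes "(x, y) \<in> {-3..-1} \<times> {1..3}" "x = -3 \<or> x = -1 \<or> y = 1 \<or> y = 3"
    and "height (x, y) \<le> 1"
  shows "x \<le> -2 \<and> y = 1 \<or> x = -3 \<and> y \<le> 2 \<or> -2 \<le> x \<and> y = 3 \<or> x = -1 \<and> 2 \<le> y"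
proof (rule ccontr)
  assume n: "\<not> ?thesis"
  then consider "x > -2" "y < 2" | "x < -2" "y > 2" using assms by force
  then show False
  proof cases
    case 1
    \<comment> \<open>A lower bound for the contribution of the other tree, which fades out at distance 1 from
      the corner \<open>(-1, 1)\<close>.\<close>
    let ?c = "min (2 + x) (2 - y)"
    have "y = 1 \<or> x = -1" using assms n 1 by auto
    then have "1 \<le> bump (x, y) \<and> ?c \<le> bump (y, x) \<or> ?c \<le> bump (x, y) \<and> 1 \<le> bump (y, x)"
      using assms 1 bump_superlevel[of 1 "(x, y)"] bump_superlevel[of 1 "(y, x)"]
       bump_superlevel[of ?c "(x, y)"] bump_superlevel[of ?c "(y, x)"]
      by (auto simp: thick_def min_def)
    then show False using assms 1 by (auto simp: height_def min_def split: if_splits)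
  next
    case 2
    \<comment> \<open>The same near the corner \<open>(-3, 3)\<close>.\<close>
    let ?c = "min (-2 - x) (y - 2)"
    have "y = 3 \<or> x = -3" using assms n 2 by auto
    then have "1 \<le> bump (x, y) \<and> ?c \<le> bump (y, x) \<or> ?c \<le> bump (x, y) \<and> 1 \<le> bump (y, x)"
      using assms 2 bump_superlevel[of 1 "(x, y)"] bump_superlevel[of 1 "(y, x)"]
       bump_superlevel[of ?c "(x, y)"] bump_superlevel[of ?c "(y, x)"]
      by (auto simp: thick_def min_def)
    then show False using assms 2 by (auto simp: height_def min_def split: if_splits)
  qed
qed

section \<open>Connected sets confined to the peak\<close>

lemma unimodal_contractible:
  assumes "unimodal u" "0 < c" "c \<le> u x"
  shows "contractible (u -` {c..})"
proof -
  obtain M where M: "\<And>c. 0 < c \<and> c \<le> M \<Longrightarrow> contractible (u -` {c..})"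
    "\<And>c. c > M \<Longrightarrow> u -` {c..} = {}"
    using assms(1) unfolding unimodal_def by metis
  have "x \<in> u -` {c..}" using assms(3) by simp
  then have "\<not> c > M" using M(2) by blast
  then show ?thesis using M(1) assms(2) by simp
qed

lemma unimodal_path_connected:
  fixes u :: "'a::real_normed_vector \<Rightarrow> real"
  assumes "unimodal u" "0 < c" "c \<le> u x"
  shows "path_connected (u -` {c..})"
  using unimodal_contractible[OF assms] contractible_imp_path_connected by blast

lemma frontier_rectangle:
  fixes p :: "real \<times> real"
  assumes "p \<in> frontier ({l..r} \<times> {b..t})"
  shows "p \<in> {l..r} \<times> {b..t} \<and> (fst p = l \<or> fst p = r \<or> snd p = b \<or> snd p = t)"
  using assms by (cases p) (auto simp: frontier_def interior_Times closure_Times interior_atLeastAtMost_real)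

text \<open>A connected set leaving the box would cross its boundary at a point of height at least 1,
  and the gate is the only one.\<close>
lemma connected_stays_in_peak_box:
  assumes "connected S" "p \<in> S" "p \<in> {2..4} \<times> {0..2}" "(2, 1) \<notin> S"
    and "\<And>q. q \<in> S \<Longrightarrow> 1 \<le> height q"
  shows "S \<subseteq> {2..4} \<times> {0..2}"
proof (rule ccontr)
  assume "\<not> S \<subseteq> {2..4} \<times> {0..2}"
  then obtain q where q: "q \<in> S" "q \<in> frontier ({2..4} \<times> {0..2})"
    using connected_Int_frontier[OF assms(1), of "{2..4} \<times> {0..2}"] assms(2,3) by blast
  then have "q = (2, 1)"
    using frontier_rectangle[OF q(2)] height_gate[of "fst q" "snd q"] assms(5)[OF q(1)]
    by (cases q) auto
  then show False using assms(4) q by simp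
qed

text \<open>Superlevel sets above level 1 are connected and cannot pass the gate, whose height is 1. So
  a summand that exceeds 1 at the peak exceeds 1 nowhere outside the box.\<close>
lemma unimodal_peak_box:
  assumes "unimodal v" "\<And>p. (v p)\<^sup>2 \<le> height p" "1 < v (3, 1)" "1 < v x"
  shows "x \<in> {2..4} \<times> {0..2}"
proof -
  define c where "c = min (v (3, 1)) (v x)"
  have c: "c > 1" "c \<le> v (3, 1)" "c \<le> v x" using assms by (auto simp: c_def)
  have h: "1 < height q" if "q \<in> v -` {c..}" for q
  proof -
    have "1 < v q" using that c by simp
    then have "1 < (v q)\<^sup>2" by simp
    then show ?thesis using assms(2)[of q] by linarith
  qed
  have "connected (v -` {c..})"
    using unimodal_path_connected[OF assms(1), of c x] c path_connected_imp_connected by auto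
  moreover have "(2, 1) \<notin> v -` {c..}" using h height_gate_eq by force
  ultimately have "v -` {c..} \<subseteq> {2..4} \<times> {0..2}"
    using connected_stays_in_peak_box[of "v -` {c..}" "(3, 1)"] c h by (simp add: less_imp_le)
  then show ?thesis using c by auto
qed

section \<open>Zeros of unimodal functions around a hole\<close>

text \<open>The radial map away from \<open>p\<close> is essential on the frontier of a bounded set around \<open>p\<close>,
  because \<open>p\<close> lies in a bounded component of the complement; on a contractible set avoiding \<open>p\<close>
  it is inessential.\<close>
lemma contractible_misses_frontier:
  fixes p :: "'a::euclidean_space"
  assumes "contractible S" "p \<notin> S" "bounded U" "p \<in> U"
  shows "\<not> frontier U \<subseteq> S"
proof
  assume sub: "frontier U \<subseteq> S"
  let ?g = "\<lambda>x. inverse (norm (x - p)) *\<^sub>R (x - p)"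
  have cp: "compact (frontier U)" using assms(3) by (rule compact_frontier_bounded)
  have pf: "p \<notin> frontier U" using sub assms(2) by blast
  have "connected_component_set (- frontier U) p \<subseteq> U"
  proof (rule ccontr)
    let ?C = "connected_component_set (- frontier U) p"
    assume "\<not> ?C \<subseteq> U"
    moreover have "p \<in> ?C" using pf by simp
    ultimately have "?C \<inter> frontier U \<noteq> {}"
      using assms(4) by (intro connected_Int_frontier connected_connected_component) blast+
    then show False using connected_component_subset by fastforce
  qed
  then have b: "bounded (connected_component_set (- frontier U) p)"
    using assms(3) bounded_subset by blast
  have ne: "norm (x - p) \<noteq> 0" if "x \<in> S" for x using that assms(2) by auto
  have "continuous_on S ?g"
    using ne by (intro continuous_intros) auto
  moreover have "?g \<in> S \<rightarrow> sphere 0 1"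
    using ne by simp
  ultimately obtain c where "homotopic_with_canon (\<lambda>h. True) S (sphere 0 1) ?g (\<lambda>x. c)"
    using nullhomotopic_from_contractible[OF _ _ assms(1)] by blast
  then have "homotopic_with_canon (\<lambda>h. True) (frontier U) (sphere 0 1) ?g (\<lambda>x. c)"
    using sub by (rule homotopic_with_subset_left)
  then show False
    using Borsuk_map_essential_bounded_component[OF cp pf] b by blast
qed

text \<open>If the minimum over the frontier were positive, the superlevel set at this minimum would be
  contractible, contain the frontier and miss \<open>p\<close>.\<close>
lemma unimodal_vanishes_on_ring:
  fixes u :: "'a::euclidean_space \<Rightarrow> real"
  assumes "unimodal u" "bounded U" "p \<in> U" "u p = 0" "frontier U \<noteq> {}"
  obtains q where "q \<in> frontier U" "u q = 0"
proof -
  have "compact (frontier U)" using assms(2) by (rule compact_frontier_bounded)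
  moreover have "continuous_on (frontier U) u"
    using assms(1) continuous_on_subset unfolding unimodal_def by blast
  ultimately obtain q where q: "q \<in> frontier U" "\<And>x. x \<in> frontier U \<Longrightarrow> u q \<le> u x"
    using continuous_attains_inf[of "frontier U" u] assms(5) by metis
  have "u q = 0"
  proof (rule ccontr)
    assume "u q \<noteq> 0"
    then have "0 < u q" using assms(1) unfolding unimodal_def by (metis order_le_less)
    moreover from this have "contractible (u -` {u q..})"
      using unimodal_contractible[OF assms(1)] by blast
    ultimately show False
      using contractible_misses_frontier[of "u -` {u q..}" p U] assms q(2) by auto
  qed
  then show thesis using that q by blast
qed

section \<open>Crossing strands\<close>

text \<open>The Fashoda meet theorem, moved from \<open>real^2\<close> to pairs and from paths to path-connected
  sets.\<close>
lemma path_connected_sets_cross: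
  fixes X Y :: "(real \<times> real) set"
  assumes "path_connected X" "path_connected Y"
    and "X \<subseteq> {l..r} \<times> {b..t}" "Y \<subseteq> {l..r} \<times> {b..t}"
    and "(l, y1) \<in> X" "(r, y2) \<in> X" "(x1, b) \<in> Y" "(x2, t) \<in> Y"
  shows "X \<inter> Y \<noteq> {}"
proof -
  define h :: "real \<times> real \<Rightarrow> real^2" where "h = (\<lambda>p. vector [fst p, snd p])"
  have h: "h p $ 1 = fst p" "h p $ 2 = snd p" for p by (simp_all add: h_def)
  have "h = (\<lambda>p. \<chi> i. if i = 1 then fst p else snd p)"
    by (simp add: fun_eq_iff vec_eq_iff forall_2 h)
  moreover have "continuous_on UNIV (\<lambda>p :: real \<times> real. if i = 1 then fst p else snd p)" for i :: 2
    by (cases "i = 1") (auto intro!: continuous_intros)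
  ultimately have "continuous_on UNIV h"
    using continuous_on_vec_lambda[of UNIV "\<lambda>(i::2) (p::real \<times> real). if i = 1 then fst p else snd p"] by simp
  then have hc: "continuous_on A h" for A using continuous_on_subset by blast
  have hbox: "h ` A \<subseteq> cbox (h (l, b)) (h (r, t))" if "A \<subseteq> {l..r} \<times> {b..t}" for A
    using that by (fastforce simp: mem_box_cart forall_2 h)
  obtain f where f: "path f" "path_image f \<subseteq> X" "pathstart f = (l, y1)" "pathfinish f = (r, y2)"
    using assms(1,5,6) unfolding path_connected_def by metis
  obtain g where g: "path g" "path_image g \<subseteq> Y" "pathstart g = (x1, b)" "pathfinish g = (x2, t)"
    using assms(2,7,8) unfolding path_connected_def by metis
  obtain z where "z \<in> path_image (h \<circ> f)" "z \<in> path_image (h \<circ> g)"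
  proof (rule fashoda[of "h \<circ> f" "h \<circ> g" "h (l, b)" "h (r, t)"])
    show "path (h \<circ> f)" "path (h \<circ> g)"
      using f g hc path_continuous_image by blast+
    show "path_image (h \<circ> f) \<subseteq> cbox (h (l, b)) (h (r, t))"
      unfolding path_image_compose by (rule hbox) (use f assms in auto)
    show "path_image (h \<circ> g) \<subseteq> cbox (h (l, b)) (h (r, t))"
      unfolding path_image_compose by (rule hbox) (use g assms in auto)
  qed (use f g in \<open>auto simp: pathstart_compose pathfinish_compose h\<close>)
  then obtain p q where "p \<in> X" "q \<in> Y" "h p = h q"
    using f g unfolding path_image_compose by blast
  moreover from this have "p = q" using h by (metis prod_eqI)
  ultimately show ?thesis by blast
qed

lemma path_connected_box: "path_connected ({l..r} \<times> {b..t} :: (real \<times> real) set)"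
  by (intro convex_imp_path_connected convex_Times) auto

lemma unimodal_nonneg: "unimodal u \<Longrightarrow> 0 \<le> u x"
  by (simp add: unimodal_def)

text \<open>Five regions which together contain the routes taken below, apart from their starting points.\<close>
lemma height_moat:
  assumes "- 4 \<le> x \<and> x \<le> - 2 \<and> 1/2 \<le> y \<and> y < 1 \<or> x < - 3 \<and> 1 \<le> y \<and> y \<le> 2
     \<or> - 2 \<le> x \<and> x \<le> - 1 \<and> 3 < y \<or> x \<le> - 1/2 \<and> y = 4 \<or> - 1 < x \<and> x \<le> - 1/2 \<and> 2 \<le> y"
  shows "height (x, y) < 1"
proof -
  obtain s t where *: "height (x, y) = s + t" "bump_branch s x y" "bump_branch t y x"
    by (rule height_cases)
  have st: "s < 1" "t < 1" "s = 0 \<or> t = 0"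
    using assms * unfolding bump_branch_def by - ((elim disjE conjE; linarith)+)
  then show ?thesis using *(1) by auto
qed

text \<open>From a thin arc the outer edge can be reached through low terrain, because there the set
  \<open>height \<ge> 1\<close> is only a curve. The routes stay in the open upper left quadrant, which separates them
  from their transposes.\<close>
lemma route_to_left_edge:
  assumes "- 3 \<le> x \<and> x \<le> - 2 \<and> y = 1 \<or> x = - 3 \<and> 1 \<le> y \<and> y \<le> 2
    \<or> - 2 \<le> x \<and> x \<le> - 1 \<and> y = 3 \<or> x = - 1 \<and> 2 \<le> y \<and> y \<le> 3"
  obtains E z where "path_connected E" "(x, y) \<in> E" "(-4, z) \<in> E" "E \<subseteq> {-4..4} \<times> {-4..4}"
    "\<And>q. q \<in> E \<Longrightarrow> q = (x, y) \<or> fst q < 0 \<and> 0 < snd q \<and> height q < 1"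
proof -
  note boxes = path_connected_Un path_connected_box
  consider "- 3 \<le> x \<and> x \<le> - 2 \<and> y = 1" | "x = - 3 \<and> 1 \<le> y \<and> y \<le> 2"
    | "- 2 \<le> x \<and> x \<le> - 1 \<and> y = 3" | "x = - 1 \<and> 2 \<le> y \<and> y \<le> 3"
    using assms by blast
  then show thesis
  proof cases
    case 1
    let ?E = "{x..x} \<times> {1/2..1::real} \<union> {-4..x} \<times> {1/2..1/2}"
    show thesis
    proof (rule that[of ?E "1/2"])
      have "(x, 1/2) \<in> {x..x} \<times> {1/2..1::real} \<inter> {-4..x} \<times> {1/2..1/2}" using 1 by auto
      then show "path_connected ?E" by (intro boxes) blast
      fix q assume "q \<in> ?E"
      then show "q = (x, y) \<or> fst q < 0 \<and> 0 < snd q \<and> height q < 1"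
        using 1 height_moat[of "fst q" "snd q"] by (cases q) auto
    qed (use 1 in auto)
  next
    case 2
    let ?E = "{-4..-3::real} \<times> {y..y}"
    show thesis
    proof (rule that[of ?E y])
      show "path_connected ?E" by (intro boxes)
      fix q assume "q \<in> ?E"
      then have "q = (x, y) \<or> fst q < - 3 \<and> snd q = y" using 2 by (cases q) auto
      then show "q = (x, y) \<or> fst q < 0 \<and> 0 < snd q \<and> height q < 1"
        using 2 height_moat[of "fst q" "snd q"] by (cases q) auto
    qed (use 2 in auto)
  next
    case 3
    let ?E = "{x..x} \<times> {3..4::real} \<union> {-4..x} \<times> {4..4}"
    show thesis
    proof (rule that[of ?E 4])
      have "(x, 4) \<in> {x..x} \<times> {3..4::real} \<inter> {-4..x} \<times> {4..4}" using 3 by auto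
      then show "path_connected ?E" by (intro boxes) blast
      fix q assume "q \<in> ?E"
      then show "q = (x, y) \<or> fst q < 0 \<and> 0 < snd q \<and> height q < 1"
        using 3 height_moat[of "fst q" "snd q"] by (cases q) auto
    qed (use 3 in auto)
  next
    case 4
    let ?E = "({-1..-1/2::real} \<times> {y..y} \<union> {-1/2..-1/2::real} \<times> {y..4}) \<union> {-4..-1/2::real} \<times> {4..4}"
    show thesis
    proof (rule that[of ?E 4])
      have "(-1/2, y) \<in> {-1..-1/2::real} \<times> {y..y} \<inter> {-1/2..-1/2::real} \<times> {y..4}"
        "(-1/2, 4) \<in> ({-1..-1/2::real} \<times> {y..y} \<union> {-1/2..-1/2::real} \<times> {y..4}) \<inter> {-4..-1/2::real} \<times> {4..4}"
        using 4 by auto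
      then show "path_connected ?E" by (intro boxes) blast+
      fix q assume "q \<in> ?E"
      then show "q = (x, y) \<or> fst q < 0 \<and> 0 < snd q \<and> height q < 1"
        using 4 height_moat[of "fst q" "snd q"] by (cases q) auto
    qed (use 4 in auto)
  qed
qed

text \<open>The set \<open>v \<ge> 1\<close> contains the peak \<open>(3, 1)\<close>. It also contains a point of the ring where \<open>w\<close>
  vanishes, since \<open>v = sqrt height \<ge> 1\<close> there; as \<open>v\<close> cannot exceed 1 off the peak box, this point
  has height exactly 1 and lies on a thin arc. Being connected, the set \<open>v \<ge> 1\<close> passes the gate, so
  that \<open>w = 0\<close> at the gate and the set \<open>w \<ge> 1\<close> is locked out of the peak box. Extending \<open>v \<ge> 1\<close> by a
  segment inside the peak box and by a route from the thin arc gives a strand from the right edge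
  to the left edge.\<close>
lemma strand_of_first_summand:
  assumes "unimodal v" "unimodal w" and sum: "\<And>p. v p + w p = sqrt (height p)"
    and peaks: "1 < v (3, 1)" "1 < w (1, 3)"
  obtains X z where "path_connected X" "X \<subseteq> {-4..4} \<times> {-4..4}" "(-4, z) \<in> X" "(4, 1) \<in> X"
    "X \<subseteq> v -` {1..} \<union> {3..4} \<times> {1} \<union> {q. fst q < 0 \<and> 0 < snd q \<and> height q < 1}"
    "\<And>q. q \<in> {2..4} \<times> {0..2} \<Longrightarrow> w q < 1"
proof -
  \<comment> \<open>The frontier of this square is the ring around the hole at \<open>(-2, 2)\<close>.\<close>
  let ?U = "{-3..-1} \<times> {1..3} :: (real \<times> real) set"
  have nn: "0 \<le> v p" "0 \<le> w p" for p using assms(1,2) unimodal_nonneg by blast+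
  have h1: "1 \<le> height p" if "1 \<le> v p \<or> 1 \<le> w p" for p
  proof -
    have "1 \<le> sqrt (height p)" using that nn[of p] sum[of p] by linarith
    then show ?thesis by simp
  qed
  have sq: "(v p)\<^sup>2 \<le> height p" for p
    using nn[of p] sum[of p] by (intro sqrt_ge_absD) simp
  have "w (-2, 2) = 0"
    using sum[of "(-2, 2)"] nn[of "(-2, 2)"] height_hole by simp
  moreover have "bounded ?U" by (intro bounded_Times) auto
  moreover from this have "frontier ?U \<noteq> {}"
    using frontier_not_empty[of ?U] not_bounded_UNIV[where 'a = "real \<times> real"] by force
  ultimately obtain P where P: "P \<in> frontier ?U" "w P = 0"
    using unimodal_vanishes_on_ring[OF assms(2), of ?U "(-2, 2)"] by auto
  obtain x y where xy: "P = (x, y)" by (cases P)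
  have ring: "(x, y) \<in> ?U" "x = -3 \<or> x = -1 \<or> y = 1 \<or> y = 3"
    using frontier_rectangle[OF P(1)] by (auto simp: xy)
  have vP: "v P = sqrt (height P)" using sum[of P] P by simp
  have "P \<notin> {2..4} \<times> {0..2}" using ring by (auto simp: xy)
  then have "v P \<le> 1"
    using unimodal_peak_box[OF assms(1) sq peaks(1), of P] by force
  then have "height P \<le> 1" using vP by simp
  then have thin: "- 3 \<le> x \<and> x \<le> - 2 \<and> y = 1 \<or> x = - 3 \<and> 1 \<le> y \<and> y \<le> 2
    \<or> - 2 \<le> x \<and> x \<le> - 1 \<and> y = 3 \<or> x = - 1 \<and> 2 \<le> y \<and> y \<le> 3"
    using height_ring_thin[OF ring] ring by (auto simp: xy)
  obtain E z where E: "path_connected E" "P \<in> E" "(-4, z) \<in> E" "E \<subseteq> {-4..4} \<times> {-4..4}"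
    "\<And>q. q \<in> E \<Longrightarrow> q = P \<or> fst q < 0 \<and> 0 < snd q \<and> height q < 1"
    using route_to_left_edge[OF thin] unfolding xy by metis
  let ?A = "v -` {1..}" and ?B = "w -` {1..}"
  have PA: "P \<in> ?A" using vP height_ring[OF ring] by (simp add: xy)
  have pA: "path_connected ?A"
    using unimodal_path_connected[OF assms(1), of 1 "(3, 1)"] peaks by simp
  have "(2, 1) \<in> ?A"
    using connected_stays_in_peak_box[of ?A "(3, 1)"] path_connected_imp_connected[OF pA]
      PA \<open>P \<notin> {2..4} \<times> {0..2}\<close> peaks h1 by fastforce
  then have gate: "(2, 1) \<notin> ?B" using sum[of "(2, 1)"] height_gate_eq by simp
  have cB: "connected ?B"
    using unimodal_path_connected[OF assms(2), of 1 "(1, 3)"] peaks path_connected_imp_connected by simp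
  have w: "w q < 1" if "q \<in> {2..4} \<times> {0..2}" for q
  proof (rule ccontr)
    assume "\<not> w q < 1"
    then have "?B \<subseteq> {2..4} \<times> {0..2}"
      using connected_stays_in_peak_box[OF cB _ that gate] h1 by simp
    moreover have "(1, 3) \<in> ?B" using peaks by simp
    ultimately show False by auto
  qed
  show thesis
  proof (rule that[of "(?A \<union> {3..4} \<times> {1..1}) \<union> E" z])
    show "path_connected ((?A \<union> {3..4} \<times> {1..1}) \<union> E)"
    proof (intro path_connected_Un pA path_connected_box E(1))
      have "(3, 1) \<in> ?A \<inter> {3..4} \<times> {1..1}" using peaks by simp
      then show "?A \<inter> {3..4} \<times> {1..1} \<noteq> {}" by blast
    qed (use PA E(2) in blast)
    have "?A \<subseteq> {-4..4} \<times> {-4..4}"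
    proof
      fix q assume "q \<in> ?A"
      then have "0 < height (fst q, snd q)" using h1[of q] by simp
      from height_support[OF this] show "q \<in> {-4..4} \<times> {-4..4}" by (cases q) simp
    qed
    then show "(?A \<union> {3..4} \<times> {1..1}) \<union> E \<subseteq> {-4..4} \<times> {-4..4}" using E(4) by auto
    show "(?A \<union> {3..4} \<times> {1..1}) \<union> E \<subseteq> ?A \<union> {3..4} \<times> {1} \<union> {q. fst q < 0 \<and> 0 < snd q \<and> height q < 1}"
    proof -
      have "E \<subseteq> ?A \<union> {q. fst q < 0 \<and> 0 < snd q \<and> height q < 1}" using E(5) PA by blast
      then show ?thesis unfolding atLeastAtMost_singleton by blast
    qed
  qed (use E w in auto)
qed

text \<open>Transposition turns the statement about \<open>v\<close> into one about \<open>w\<close>, with a strand from the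
  bottom edge to the top edge. The two strands must cross, but they are disjoint: the extensions
  run where the other summand is below 1 and in separate parts of the plane, and a common point of
  \<open>v \<ge> 1\<close> and \<open>w \<ge> 1\<close> would have height at least 4, hence lie in a peak box, where one of the two
  is below 1.\<close>
lemma no_decomposition_with_split_peaks:
  assumes "unimodal v" "unimodal w" and sum: "\<And>p. v p + w p = sqrt (height p)"
    and peaks: "1 < v (3, 1)" "1 < w (1, 3)"
  shows False
proof -
  obtain X z where X: "path_connected X" "X \<subseteq> {-4..4} \<times> {-4..4}" "(-4, z) \<in> X" "(4, 1) \<in> X"
    "X \<subseteq> v -` {1..} \<union> {3..4} \<times> {1} \<union> {q. fst q < 0 \<and> 0 < snd q \<and> height q < 1}"
    and w: "\<And>q. q \<in> {2..4} \<times> {0..2} \<Longrightarrow> w q < 1"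
    using strand_of_first_summand[OF assms] by blast
  have sum': "(w \<circ> prod.swap) p + (v \<circ> prod.swap) p = sqrt (height p)" for p
    using sum[of "prod.swap p"] by (simp add: add.commute)
  have peaks': "1 < (w \<circ> prod.swap) (3, 1)" "1 < (v \<circ> prod.swap) (1, 3)"
    using peaks by simp_all
  obtain X' z' where X': "path_connected X'" "X' \<subseteq> {-4..4} \<times> {-4..4}" "(-4, z') \<in> X'" "(4, 1) \<in> X'"
    "X' \<subseteq> (w \<circ> prod.swap) -` {1..} \<union> {3..4} \<times> {1} \<union> {q. fst q < 0 \<and> 0 < snd q \<and> height q < 1}"
    and v': "\<And>q. q \<in> {2..4} \<times> {0..2} \<Longrightarrow> (v \<circ> prod.swap) q < 1"
    using strand_of_first_summand[OF unimodal_swap[OF assms(2)] unimodal_swap[OF assms(1)] sum' peaks']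
    by blast
  have v: "v q < 1" if "q \<in> {0..2} \<times> {2..4}" for q
    using v'[of "prod.swap q"] that by (cases q) auto
  let ?Y = "prod.swap ` X'"
  have "X \<inter> ?Y \<noteq> {}"
  proof (rule path_connected_sets_cross[of X ?Y "-4" 4 "-4" 4 z 1 z' 1])
    show "path_connected ?Y"
      using X'(1) by (intro path_connected_continuous_image continuous_on_swap)
    show "?Y \<subseteq> {-4..4} \<times> {-4..4}" using X'(2) by auto
    show "(z', -4) \<in> ?Y" "(1, 4) \<in> ?Y" using X'(3,4) by force+
  qed (use X in auto)
  then obtain x y where q: "(x, y) \<in> X" "(y, x) \<in> X'" by auto
  have nn: "0 \<le> v p" "0 \<le> w p" for p using assms(1,2) unimodal_nonneg by blast+
  have h1: "1 \<le> height p" if "1 \<le> v p \<or> 1 \<le> w p" for p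
  proof -
    have "1 \<le> sqrt (height p)" using that nn[of p] sum[of p] by linarith
    then show ?thesis by simp
  qed
  have 1: "1 \<le> v (x, y) \<or> 3 \<le> x \<and> x \<le> 4 \<and> y = 1 \<or> x < 0 \<and> 0 < y \<and> height (x, y) < 1"
    using q(1) X(5) by auto
  have 2: "1 \<le> w (x, y) \<or> 3 \<le> y \<and> y \<le> 4 \<and> x = 1 \<or> y < 0 \<and> 0 < x \<and> height (x, y) < 1"
    using q(2) X'(5) height_swap[of "(x, y)"] by auto
  have "\<not> (1 \<le> v (x, y) \<and> 1 \<le> w (x, y))"
  proof
    assume a: "1 \<le> v (x, y) \<and> 1 \<le> w (x, y)"
    then have "2 \<le> sqrt (height (x, y))" using sum[of "(x, y)"] by linarith
    then have "4 \<le> height (x, y)" using sqrt_ge_absD[of 2 "height (x, y)"] by simp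
    then show False
      using height_off_peaks[of "(x, y)"] v[of "(x, y)"] w[of "(x, y)"] a by force
  qed
  then show False
    using 1 2 h1[of "(x, y)"] w[of "(x, y)"] v[of "(x, y)"] by auto
qed

lemma peaks_not_in_common_superlevel:
  assumes "unimodal u" "\<And>p. (u p)\<^sup>2 \<le> height p"
  shows "u (3, 1) \<le> 1 \<or> u (1, 3) \<le> 1"
  using unimodal_peak_box[OF assms, of "(1, 3)"] by force

text \<open>At each peak the sum is \<open>sqrt 5 > 2\<close>, so one summand exceeds 1 there, and no summand does so
  at both peaks. Hence the summands share the peaks between them.\<close>
lemma sqrt_height_not_sum_of_two:
  assumes "unimodal v" "unimodal w" and sum: "\<And>p. sqrt (height p) = v p + w p"
  shows False
proof -
  have nn: "0 \<le> v p" "0 \<le> w p" for p using assms(1,2) unimodal_nonneg by blast+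
  have sq: "(v p)\<^sup>2 \<le> height p" "(w p)\<^sup>2 \<le> height p" for p
    using nn[of p] sum[of p] by (auto intro!: sqrt_ge_absD)
  have "2 < sqrt (5::real)" by (rule real_less_rsqrt) simp
  moreover have "height (1, 3) = 5" using height_swap[of "(3, 1)"] height_peak by simp
  ultimately have "2 < v (3, 1) + w (3, 1)" "2 < v (1, 3) + w (1, 3)"
    using sum[of "(3, 1)"] sum[of "(1, 3)"] height_peak by simp_all
  then have "1 < v (3, 1) \<and> 1 < w (1, 3) \<or> 1 < w (3, 1) \<and> 1 < v (1, 3)"
    using peaks_not_in_common_superlevel[OF assms(1) sq(1)]
      peaks_not_in_common_superlevel[OF assms(2) sq(2)] by linarith
  then show False
    using no_decomposition_with_split_peaks[of v w] no_decomposition_with_split_peaks[of w v]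
      assms by (auto simp: add.commute)
qed

section \<open>Counting unimodal summands\<close>

text \<open>The top superlevel set contains both peaks and is therefore disconnected.\<close>
lemma two_peaks_not_unimodal:
  assumes "0 < c" "\<And>p. c \<le> g p \<longleftrightarrow> 5 \<le> height p"
  shows "\<not> unimodal g"
proof
  assume "unimodal g"
  then have "connected (g -` {c..})"
    using unimodal_path_connected[of g c "(3, 1)"] assms height_peak path_connected_imp_connected by simp
  then have "g -` {c..} \<subseteq> {2..4} \<times> {0..2}"
    by (rule connected_stays_in_peak_box[of _ "(3, 1)"]) (auto simp: assms(2) height_peak height_gate_eq)
  moreover have "(1, 3) \<in> g -` {c..}"
    using assms(2) height_swap[of "(3, 1)"] height_peak by simp
  ultimately show False by force
qed

lemma ucat_pow_le:
  assumes "\<And>i. i < n \<Longrightarrow> unimodal (u i)" "\<And>x. f x = (\<Sum>i<n. u i x powr p) powr (1 / p)"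
  shows "ucat_pow p f \<le> enat n"
  unfolding ucat_pow_def using assms by (intro Inf_lower) blast

lemma ucat_pow_ge:
  fixes f :: "'a::topological_space \<Rightarrow> real"
  assumes "\<And>k u. \<lbrakk>k < n; \<And>i. i < k \<Longrightarrow> unimodal (u i);
    \<And>x. f x = (\<Sum>i<k. u i x powr p) powr (1 / p)\<rbrakk> \<Longrightarrow> False"
  shows "enat n \<le> ucat_pow p f"
  unfolding ucat_pow_def
proof (rule Inf_greatest, clarify)
  fix k and u :: "nat \<Rightarrow> 'a \<Rightarrow> real"
  assume "\<forall>i<k. unimodal (u i)" "\<forall>x. f x = (\<Sum>i<k. u i x powr p) powr (1 / p)"
  then have "\<not> k < n" using assms by blast
  then show "enat n \<le> enat k" by simp
qed

text \<open>The empty sum is 0, and a sum with one term returns the term itself, because the outer power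
  undoes the inner one on nonnegative numbers.\<close>
lemma not_unimodal_decomposition:
  fixes k :: nat
  assumes "0 < p" "\<not> unimodal f" "f x \<noteq> 0" "k < 2"
    and "\<And>i. i < k \<Longrightarrow> unimodal (u i)" "\<And>x. f x = (\<Sum>i<k. u i x powr p) powr (1 / p)"
  shows False
proof (cases k)
  case 0
  then show False using assms(3,6) by simp
next
  case (Suc m)
  then have k: "k = 1" using assms(4) by simp
  then have u: "unimodal (u 0)" using assms(5) by simp
  then have "0 \<le> u 0 x" for x by (rule unimodal_nonneg)
  then have "f = u 0"
    using assms(1,6) by (auto simp: k powr_powr fun_eq_iff)
  then show False using u assms(2) by simp
qed

theorem proposition4p11:
  fixes a :: "real \<times> real" and K :: "(real \<times> real) set"
    and u1 u2 F f :: "real \<times> real \<Rightarrow> real"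
  assumes a: "a = (3, 1)"
    and K: "K = ({-1..1} \<times> {-1..1}) \<union> ({-3..3} \<times> {1}) \<union> ({1..3} \<times> {-1})
                \<union> ({-3} \<times> {1..3}) \<union> ({3} \<times> {-3..-1})"
    and u1: "\<And>p. u1 p = Max {0, 1 - setdist_max p K, 5 - 5 * dist_max p a}"
    and u2: "\<And>x y. u2 (x, y) = u1 (y, x)"
    and F: "\<And>p. F p = u1 p + u2 p"
    and f: "\<And>p. f p = sqrt (u1 p + u2 p)"
  shows "ucat_pow 2 f = 2 \<and> ucat F = 2 \<and> ucat f \<ge> 3
    \<and> \<not> (\<forall>p1 p2. 0 < p1 \<and> p1 < p2 \<longrightarrow> ucat_pow p1 f \<le> ucat_pow p2 f)"
proof -
  have u1: "u1 = bump"
    unfolding fun_eq_iff u1 K setdist_max_spine a by (simp add: bump_def)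
  have u2: "u2 = bump \<circ> prod.swap"
    using u2 by (auto simp: fun_eq_iff u1)
  have F: "F = height" and f: "f = (\<lambda>p. sqrt (height p))"
    unfolding fun_eq_iff F f by (simp_all add: u1 u2 height_def)
  have un: "unimodal u1" "unimodal u2"
    unfolding u1 u2 using unimodal_bump unimodal_swap by auto
  \<comment> \<open>The upper bounds: \<open>F\<close> is the sum of the two bumps, and the squares of their square roots
    sum to the square of \<open>f\<close>.\<close>
  define u where "u = (\<lambda>i::nat. if i = 0 then u1 else u2)"
  have u: "unimodal (u i)" for i using un by (simp add: u_def)
  have nn: "0 \<le> u i p" for i p using u by (rule unimodal_nonneg)
  have sum: "height p = (\<Sum>i<2. u i p)" for p
    by (simp add: u_def u1 u2 height_def numeral_2_eq_2)
  have "ucat_pow 2 f \<le> enat 2"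
  proof (rule ucat_pow_le)
    show "unimodal (\<lambda>p. sqrt (u i p))" for i using u by (rule unimodal_sqrt)
    show "f p = (\<Sum>i<2. sqrt (u i p) powr 2) powr (1 / 2)" for p
      using nn by (simp add: f sum powr_half_sqrt sum_nonneg)
  qed
  moreover have "ucat F \<le> enat 2"
    by (rule ucat_pow_le[OF u]) (use nn in \<open>simp add: F sum sum_nonneg\<close>)
  moreover have nF: "\<not> unimodal F" unfolding F by (rule two_peaks_not_unimodal[of 5]) auto
  moreover have nf: "\<not> unimodal f" unfolding f by (rule two_peaks_not_unimodal[of "sqrt 5"]) auto
  have pos: "f (3, 1) \<noteq> 0" "F (3, 1) \<noteq> 0" using height_peak by (auto simp: f F)
  have "enat 2 \<le> ucat_pow 2 f"
    by (intro ucat_pow_ge not_unimodal_decomposition[where p = 2, OF _ nf pos(1)]) auto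
  moreover have "enat 2 \<le> ucat F"
    by (intro ucat_pow_ge not_unimodal_decomposition[OF zero_less_one nF pos(2)]) auto
  moreover have "enat 3 \<le> ucat f"
  proof (rule ucat_pow_ge)
    fix k and v :: "nat \<Rightarrow> real \<times> real \<Rightarrow> real"
    assume k: "k < 3" and v: "\<And>i. i < k \<Longrightarrow> unimodal (v i)"
      and fv: "\<And>x. f x = (\<Sum>i<k. v i x powr 1) powr (1 / 1)"
    show False
    proof (cases "k = 2")
      case True
      have "0 \<le> v 0 p" "0 \<le> v 1 p" for p 
        using unimodal_nonneg[OF v[of 0]] unimodal_nonneg[OF v[of 1]] True by simp_all
      then have "sqrt (height p) = v 0 p + v 1 p" for p
        using fv[of p] by (simp add: f True numeral_2_eq_2)
      then show False using sqrt_height_not_sum_of_two[of "v 0" "v 1"] v True by simp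
    next
      case False
      then show False
        using not_unimodal_decomposition[OF _ nf pos(1), of 1 k v] k v fv by simp
    qed
  qed
  ultimately have *: "ucat_pow 2 f = 2 \<and> ucat F = 2 \<and> ucat f \<ge> 3"
    by (simp add: numeral_eq_enat order_antisym)
  moreover have "\<not> ucat_pow 1 f \<le> ucat_pow 2 f"
  proof
    assume "ucat_pow 1 f \<le> ucat_pow 2 f"
    then have "(3::enat) \<le> 2" using * order_trans by metis
    then show False by simp
  qed
  then have "\<not> (\<forall>p1 p2. 0 < p1 \<and> p1 < p2 \<longrightarrow> ucat_pow p1 f \<le> ucat_pow p2 f)"
    by (metis one_less_numeral_iff semiring_norm(76) zero_less_one)
  ultimately show ?thesis by blast
qed

end
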